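(* Fix $s\in(0,\infty)$, $m,n\in\mathbb{N}$ and $a\in\mathbb{C}$, and consider the Toeplitz operator $T_{\varphi}$ on $A^2(\mathbb{D})$ with symbol $\varphi(z)=z^{n}|z|^{2s}+a\bar{z}^{m}$. If $T_{\varphi}$ is hyponormal, then \[ |a|^2\leq\min\left\{\frac{(m+1)(n+1)}{(n+s+1)^2},\frac{n(n+2s)}{m^2}\right\}. \]
   Context: $\mathbb{N}$ denotes the positive integers. $\mathbb{D}$ is the open unit disk in $\mathbb{C}$ and $dA$ is normalized area measure on $\mathbb{D}$. The Bergman space $A^2(\mathbb{D})$ is the Hilbert space of analytic functions $f$ on $\mathbb{D}$ with $\int_{\mathbb{D}}|f|^2\,dA<\infty$, with inner product $\langle f,g\rangle=\int_{\mathbb{D}}f\bar{g}\,dA$. For $\varphi\in L^{\infty}(\mathbb{D})$, the Toeplitz operator $T_{\varphi}:A^2(\mathbb{D})\rightarrow A^2(\mathbb{D})$ is defined by $T_{\varphi}(f)=P(\varphi f)$, where $P:L^2(\mathbb{D},dA)\rightarrow A^2(\mathbb{D})$ is the orthogonal projection. A bounded operator $T$ on a Hilbert space is hyponormal if $[T^*,T]=T^*T-TT^*\geq0$. *)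

theory Defs
  imports "HOL-Complex_Analysis.Complex_Analysis"
begin

definition disk_area :: "complex measure" where
  "disk_area = density (lebesgue_on (ball 0 1)) (\<lambda>_. ennreal (1 / pi))"

text \<open>Functions on the disk are total functions on the plane; elements of the Bergman space are
  normalised to vanish off the disk, so that equality of elements is equality of functions.\<close>

definition bergman :: "(complex \<Rightarrow> complex) set" where
  "bergman = {f. f holomorphic_on ball 0 1
      \<and> integrable disk_area (\<lambda>z. (cmod (f z))\<^sup>2)
      \<and> (\<forall>z. z \<notin> ball 0 1 \<longrightarrow> f z = 0)}"

definition disk_inner :: "(complex \<Rightarrow> complex) \<Rightarrow> (complex \<Rightarrow> complex) \<Rightarrow> complex" where
  "disk_inner f g = (LINT z|disk_area. f z * cnj (g z))"

definition disk_norm :: "(complex \<Rightarrow> complex) \<Rightarrow> real" where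
  "disk_norm f = sqrt (LINT z|disk_area. (cmod (f z))\<^sup>2)"

text \<open>Meaningful for square-integrable \<open>f\<close>, where the orthogonal projection exists and is unique.\<close>

definition bergman_proj :: "(complex \<Rightarrow> complex) \<Rightarrow> complex \<Rightarrow> complex" where
  "bergman_proj f = (THE p. p \<in> bergman \<and> (\<forall>h\<in>bergman. disk_inner (\<lambda>z. f z - p z) h = 0))"

text \<open>Intended for symbols that are measurable and essentially bounded on the disk.\<close>

definition toeplitz ::
  "(complex \<Rightarrow> complex) \<Rightarrow> (complex \<Rightarrow> complex) \<Rightarrow> complex \<Rightarrow> complex" where
  "toeplitz \<phi> f = bergman_proj (\<lambda>z. \<phi> z * f z)"

definition bounded_operator :: "((complex \<Rightarrow> complex) \<Rightarrow> complex \<Rightarrow> complex) \<Rightarrow> bool" where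
  "bounded_operator T \<longleftrightarrow>
     (\<forall>f\<in>bergman. T f \<in> bergman)
   \<and> (\<forall>f\<in>bergman. \<forall>g\<in>bergman. T (\<lambda>z. f z + g z) = (\<lambda>z. T f z + T g z))
   \<and> (\<forall>c. \<forall>f\<in>bergman. T (\<lambda>z. c * f z) = (\<lambda>z. c * T f z))
   \<and> (\<exists>B. \<forall>f\<in>bergman. disk_norm (T f) \<le> B * disk_norm f)"

definition is_adjoint ::
  "((complex \<Rightarrow> complex) \<Rightarrow> complex \<Rightarrow> complex) \<Rightarrow>
   ((complex \<Rightarrow> complex) \<Rightarrow> complex \<Rightarrow> complex) \<Rightarrow> bool" where
  "is_adjoint T S \<longleftrightarrow>
     (\<forall>f\<in>bergman. S f \<in> bergman)
   \<and> (\<forall>f\<in>bergman. \<forall>g\<in>bergman. disk_inner (T f) g = disk_inner f (S g))"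

definition positive_operator :: "((complex \<Rightarrow> complex) \<Rightarrow> complex \<Rightarrow> complex) \<Rightarrow> bool" where
  "positive_operator A \<longleftrightarrow> (\<forall>f\<in>bergman. disk_inner (A f) f \<in> \<real>\<^sub>\<ge>\<^sub>0)"

text \<open>A bounded operator has exactly one adjoint on the Bergman space, so the existential
  quantifier merely names \<open>T\<^sup>*\<close>.\<close>

definition hyponormal :: "((complex \<Rightarrow> complex) \<Rightarrow> complex \<Rightarrow> complex) \<Rightarrow> bool" where
  "hyponormal T \<longleftrightarrow> bounded_operator T
     \<and> (\<exists>S. is_adjoint T S \<and> positive_operator (\<lambda>f z. S (T f) z - T (S f) z))"

end

theory Submission
  imports Defs "HOL-Real_Asymp.Real_Asymp"
begin

text \<open>Hyponormality of \<open>T\<close> means \<open>\<parallel>T\<^sup>* f\<parallel> \<le> \<parallel>T f\<parallel>\<close> for every \<open>f\<close> in the Bergman space, and both bounds come from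
  monomials \<open>f = z\<^sup>k\<close>. These are orthogonal with \<open>\<parallel>z\<^sup>k\<parallel>\<^sup>2 = 1 / (k + 1)\<close>, and the operator acts on them by
  weighted shifts: for \<open>k \<ge> m\<close>, \<open>T z\<^sup>k\<close> is the sum of
  \<open>(n + k + 1) / (n + k + s + 1) z\<^bsup>n+k\<^esup>\<close> and \<open>a (k - m + 1) / (k + 1) z\<^bsup>k-m\<^esup>\<close>, while for \<open>k = 0\<close> only the first
  summand is present (\<open>toeplitz_monomial\<close>, \<open>disk_inner_cnj_power_monomial\<close>, \<open>disk_inner_cnj_power_one\<close>).

  For \<open>k = 0\<close> the adjoint has the component \<open>cnj a z\<^sup>m\<close>, and comparing norms gives
  \<open>|a|\<^sup>2 / (m + 1) \<le> (n + 1) / (n + s + 1)\<^sup>2\<close>, the first bound. For large \<open>k\<close> the comparison reads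
  \<open>(k - n + 1) / (k + s + 1)\<^sup>2 + |a|\<^sup>2 / (k + m + 1) \<le> (n + k + 1) / (n + k + s + 1)\<^sup>2 + |a|\<^sup>2 (k - m + 1) / (k + 1)\<^sup>2\<close>;
  multiplying by \<open>k\<^sup>3\<close> and letting \<open>k\<close> tend to infinity yields \<open>|a|\<^sup>2 m\<^sup>2 \<le> n (n + 2 s)\<close>, the second bound
  (\<open>coefficient_bound_of_large_monomials\<close>). A lower bound for the norm of \<open>T\<^sup>* z\<^sup>k\<close> is enough, so Bessel's
  inequality (\<open>bessel_inequality_pair\<close>) replaces a computation of the adjoint; its monomial coefficients
  are read off from those of \<open>T\<close>.

  To know the projection one needs the inner product of \<open>z\<^sup>j w(|z|)\<close> with an arbitrary Bergman function \<open>h\<close>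
  (\<open>disk_inner_radial\<close>). Area measure is rotation invariant, so the integrand can be averaged over circles
  about the origin, and Cauchy's formula turns the average into the Taylor coefficient of \<open>h\<close> of degree \<open>j\<close>
  times a radial integral. The radial integrals are elementary since \<open>|z|\<^sup>2\<close> is uniformly distributed.\<close>

section \<open>Rotation invariance of planar Lebesgue measure\<close>

lemma measurable_linear_borel:
  fixes f :: "'a::euclidean_space \<Rightarrow> 'b::euclidean_space"
  shows "linear f \<Longrightarrow> f \<in> borel_measurable borel"
  by (intro borel_measurable_continuous_onI linear_continuous_on linear_conv_bounded_linear[THEN iffD1])

text \<open>It is enough to test boxes; the preimage of a box is its image under the inverse map, which is
  again orthogonal and so preserves volume.\<close>

lemma distr_lborel_orthogonal:
  fixes f :: "real ^ 'n::{finite,wellorder} \<Rightarrow> real ^ 'n::_"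
  assumes "orthogonal_transformation f"
  shows "distr lborel borel f = lborel"
proof (rule lborel_eqI[symmetric])
  have lin: "linear f" using assms by (rule orthogonal_transformation_linear)
  then have [measurable]: "f \<in> borel_measurable borel"
    by (rule measurable_linear_borel)
  fix l u :: "(real, 'n) vec" assume le: "\<And>b. b \<in> Basis \<Longrightarrow> l \<bullet> b \<le> u \<bullet> b"
  have bij: "bij f" using assms by (rule orthogonal_transformation_bij)
  have pre: "f -` box l u = inv f ` box l u" using bij by (simp add: bij_vimage_eq_inv_image)
  have ort: "orthogonal_transformation (inv f)" using assms by (rule orthogonal_transformation_inv)
  have lm: "box l u \<in> lmeasurable" by simp
  have "emeasure (distr lborel borel f) (box l u) = emeasure lebesgue (inv f ` box l u)"
  proof -
    have "f -` box l u \<inter> space borel \<in> sets borel" by (rule measurable_sets[of f borel borel]) simp_all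
    then have "inv f ` box l u \<in> sets lborel" by (simp add: pre)
    then show ?thesis by (simp add: emeasure_distr pre)
  qed
  also have "\<dots> = ennreal (measure lebesgue (inv f ` box l u))"
    using measurable_orthogonal_image[OF ort lm] by (simp add: emeasure_eq_measure2 fmeasurableD2)
  also have "\<dots> = ennreal (measure lebesgue (box l u))"
    using measure_orthogonal_image[OF ort lm] by simp
  also have "\<dots> = (\<Prod>b\<in>Basis. (u - l) \<bullet> b)" 
  proof -
    have "emeasure lebesgue (box l u) = (\<Prod>b\<in>Basis. (u - l) \<bullet> b)"
      using le by (simp add: emeasure_lborel_box)
    then show ?thesis using lm by (simp add: emeasure_eq_measure2 fmeasurableD2)
  qed
  finally show "emeasure (distr lborel borel f) (box l u) = (\<Prod>b\<in>Basis. (u - l) \<bullet> b)" .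
qed simp

text \<open>In the coordinates of \<open>real ^ 2\<close>, multiplication by a complex number of modulus 1 becomes an orthogonal
  map, to which the preceding lemma applies.\<close>

definition vec_of_complex :: "complex \<Rightarrow> real ^ 2" where
  "vec_of_complex z = vector [Re z, Im z]"

definition complex_of_vec :: "real ^ 2 \<Rightarrow> complex" where
  "complex_of_vec v = Complex (v $ 1) (v $ 2)"

lemma vec_of_complex_inverse [simp]: "complex_of_vec (vec_of_complex z) = z"
  by (simp add: vec_of_complex_def complex_of_vec_def)

lemma complex_of_vec_inverse [simp]: "vec_of_complex (complex_of_vec v) = v"
  by (simp add: vec_of_complex_def complex_of_vec_def vec_eq_iff forall_2)

lemma linear_vec_of_complex: "linear vec_of_complex"
  by (rule linearI) (simp_all add: vec_of_complex_def vec_eq_iff forall_2)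

lemma linear_complex_of_vec: "linear complex_of_vec"
  by (rule linearI) (simp_all add: complex_of_vec_def complex_eq_iff)

lemma norm_vec_of_complex: "norm (vec_of_complex z) = cmod z"
  by (simp add: vec_of_complex_def norm_vec_def L2_set_def sum_2 cmod_def)

lemma norm_complex_of_vec: "cmod (complex_of_vec v) = norm v"
  by (metis complex_of_vec_inverse norm_vec_of_complex)

lemma distr_vec_of_complex: "distr lborel borel vec_of_complex = lborel"
proof (rule lborel_eqI[symmetric])
  note [measurable] = measurable_linear_borel[OF linear_vec_of_complex]
  fix l u :: "real ^ 2" assume le: "\<And>b. b \<in> Basis \<Longrightarrow> l \<bullet> b \<le> u \<bullet> b"
  have le': "l $ i \<le> u $ i" for i
    using le[of "axis i 1"] by (simp add: inner_axis)
  have pre: "vec_of_complex -` box l u = box (complex_of_vec l) (complex_of_vec u)"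
    by (auto simp: mem_box_cart vec_of_complex_def complex_of_vec_def mem_box Basis_complex_def forall_2)
  have B: "(Basis :: (real^2) set) = {axis 1 1, axis 2 1}"
    by (auto simp: Basis_vec_def UNIV_2)
  have "emeasure (distr lborel borel vec_of_complex) (box l u)
     = emeasure lborel (box (complex_of_vec l) (complex_of_vec u))"
    by (simp add: emeasure_distr pre)
  also have "\<dots> = ennreal ((u $ 1 - l $ 1) * (u $ 2 - l $ 2))"
    using le' by (subst emeasure_lborel_box)
      (auto simp: complex_of_vec_def Basis_complex_def)
  also have "\<dots> = (\<Prod>b\<in>Basis. (u - l) \<bullet> b)"
    by (simp add: B axis_eq_axis inner_axis)
  finally show "emeasure (distr lborel borel vec_of_complex) (box l u)
      = (\<Prod>b\<in>Basis. (u - l) \<bullet> b)" .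
qed simp

lemma distr_lborel_rotation:
  fixes u :: complex
  assumes "cmod u = 1"
  shows "distr lborel borel (\<lambda>z. u * z) = lborel"
proof -
  define R where "R = vec_of_complex \<circ> (\<lambda>z. u * z) \<circ> complex_of_vec"
  have "linear (\<lambda>z. u * z)" by (simp add: linear_times)
  then have "linear R" unfolding R_def
    by (intro linear_compose linear_complex_of_vec linear_vec_of_complex)
  moreover have "norm (R v) = norm v" for v
    using assms by (simp add: R_def norm_vec_of_complex norm_complex_of_vec norm_mult)
  ultimately have R: "orthogonal_transformation R" by (simp add: orthogonal_transformation)
  have m [measurable]: "vec_of_complex \<in> borel_measurable borel" "complex_of_vec \<in> borel_measurable borel"
      "R \<in> borel_measurable borel"
    by (intro measurable_linear_borel linear_vec_of_complex linear_complex_of_vec \<open>linear R\<close>)+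
  have C: "distr lborel borel complex_of_vec = lborel"
  proof -
    have "distr lborel borel complex_of_vec
        = distr (distr lborel borel vec_of_complex) borel complex_of_vec"
      by (simp only: distr_vec_of_complex)
    also have "\<dots> = distr lborel borel (complex_of_vec \<circ> vec_of_complex)"
      by (rule distr_distr) simp_all
    also have "\<dots> = lborel" by (simp add: comp_def distr_id2)
    finally show ?thesis .
  qed
  have "(\<lambda>z. u * z) = complex_of_vec \<circ> (R \<circ> vec_of_complex)"
    by (simp add: R_def fun_eq_iff)
  then have "distr lborel borel (\<lambda>z. u * z)
      = distr (distr (distr lborel borel vec_of_complex) borel R) borel complex_of_vec"
    by (simp add: distr_distr comp_def del: distr_vec_of_complex)
  also have "\<dots> = lborel"
    by (simp only: distr_vec_of_complex distr_lborel_orthogonal[OF R] C)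
  finally show ?thesis .
qed

section \<open>Normalised area measure\<close>

text \<open>The normalised area as a measure on the Borel sets of the whole plane. For Borel functions it gives
  the same integrals as \<open>disk_area\<close>, but it has no completion and no restricted carrier, which makes
  image measures and Fubini's theorem directly applicable.\<close>

definition disk_borel :: "complex measure" where
  "disk_borel = density lborel (\<lambda>z. ennreal (indicator (ball 0 1) z / pi))"

lemma borel_measurable_indicator_disk [measurable]:
  "(\<lambda>z::complex. indicator (ball 0 1) z / pi) \<in> borel_measurable borel"
  by (intro borel_measurable_divide borel_measurable_indicator) auto

lemma sets_disk_borel [simp, measurable_cong]: "sets disk_borel = sets borel"
  by (simp add: disk_borel_def)

lemma space_disk_borel [simp]: "space disk_borel = UNIV"
  by (simp add: disk_borel_def)

lemma space_disk_area [simp]: "space disk_area = ball 0 1"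
  by (simp add: disk_area_def)

lemma borel_measurable_disk_area:
  "f \<in> borel_measurable borel \<Longrightarrow> f \<in> borel_measurable disk_area"
  unfolding disk_area_def
  by (simp add: measurable_restrict_space1 measurable_completion)

lemma AE_disk_borel: "AE z in disk_borel. z \<in> ball 0 1"
  unfolding disk_borel_def by (subst AE_density) (auto simp: indicator_def)

lemma
  fixes F :: "complex \<Rightarrow> 'b::{banach, second_countable_topology}"
  assumes [measurable]: "F \<in> borel_measurable borel"
  shows integral_disk_area: "integral\<^sup>L disk_area F = integral\<^sup>L disk_borel F"
    and integrable_disk_area: "integrable disk_area F \<longleftrightarrow> integrable disk_borel F"
proof -
  have m: "F \<in> borel_measurable (lebesgue_on (ball 0 1))"
    by (simp add: measurable_restrict_space1 measurable_completion)
  have e: "(\<lambda>z. indicator (ball 0 1) z *\<^sub>R (1 / pi) *\<^sub>R F z) = (\<lambda>z. (indicator (ball 0 1) z / pi) *\<^sub>R F z)"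
    by auto
  have "integral\<^sup>L disk_area F = (LINT z|lebesgue_on (ball 0 1). (1 / pi) *\<^sub>R F z)"
    unfolding disk_area_def using m by (subst integral_density) simp_all
  also have "\<dots> = (LINT z|lebesgue. (indicator (ball 0 1) z / pi) *\<^sub>R F z)"
    by (subst integral_restrict_space) (simp_all add: e del: scaleR_scaleR)
  also have "\<dots> = (LINT z|lborel. (indicator (ball 0 1) z / pi) *\<^sub>R F z)"
    by (rule integral_completion) simp
  also have "\<dots> = integral\<^sup>L disk_borel F"
    unfolding disk_borel_def by (subst integral_density) (simp_all add: indicator_def)
  finally show "integral\<^sup>L disk_area F = integral\<^sup>L disk_borel F" .
  have "integrable disk_area F \<longleftrightarrow> integrable (lebesgue_on (ball 0 1)) (\<lambda>z. (1 / pi) *\<^sub>R F z)"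
    unfolding disk_area_def using m by (subst integrable_density) simp_all
  also have "\<dots> \<longleftrightarrow> integrable lebesgue (\<lambda>z. (indicator (ball 0 1) z / pi) *\<^sub>R F z)"
    by (subst integrable_restrict_space) (simp_all only: e, simp_all)
  also have "\<dots> \<longleftrightarrow> integrable lborel (\<lambda>z. (indicator (ball 0 1) z / pi) *\<^sub>R F z)"
    by (rule integrable_completion) simp
  also have "\<dots> \<longleftrightarrow> integrable disk_borel F"
    unfolding disk_borel_def by (subst integrable_density) (simp_all add: indicator_def)
  finally show "integrable disk_area F \<longleftrightarrow> integrable disk_borel F" .
qed

lemma emeasure_disk_borel_cball:
  assumes "0 \<le> r" "r \<le> 1"
  shows "emeasure disk_borel (cball 0 r) = ennreal (r\<^sup>2)"
proof -
  have "emeasure disk_borel (ball 0 1 \<inter> cball 0 r) = (\<integral>\<^sup>+z. ennreal (1/pi) * indicator (ball 0 1 \<inter> cball 0 r :: complex set) z \<partial>lborel)"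
    unfolding disk_borel_def
    by (subst emeasure_density) (auto intro!: nn_integral_cong split: split_indicator)
  also have "\<dots> = ennreal (1/pi) * emeasure lborel (ball 0 1 \<inter> cball 0 r :: complex set)"
    by (subst nn_integral_cmult_indicator) auto
  also have "emeasure lborel (ball 0 1 \<inter> cball 0 r :: complex set) = ennreal (pi * r\<^sup>2)"
  proof (cases "r = 1")
    case True
    have "ball 0 1 \<inter> cball 0 1 = (ball 0 1 :: complex set)" by auto
    with True show ?thesis by (simp add: emeasure_ball unit_ball_vol_2)
  next
    case False
    then have "ball 0 1 \<inter> cball 0 r = (cball 0 r :: complex set)" using assms by auto
    with assms show ?thesis by (simp add: emeasure_cball unit_ball_vol_2)
  qed
  also have "ennreal (1/pi) * ennreal (pi * r\<^sup>2) = ennreal (r\<^sup>2)"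
    by (simp flip: ennreal_mult)
  also have "emeasure disk_borel (ball 0 1 \<inter> cball 0 r) = emeasure disk_borel (cball 0 r)"
    using AE_disk_borel by (intro emeasure_eq_AE) auto
  finally show ?thesis .
qed

lemma emeasure_disk_borel_UNIV [simp]: "emeasure disk_borel UNIV = 1"
proof -
  have "emeasure disk_borel UNIV = emeasure disk_borel (cball 0 1)"
    using AE_disk_borel by (intro emeasure_eq_AE) auto
  then show ?thesis by (simp add: emeasure_disk_borel_cball)
qed

interpretation disk_borel: finite_measure disk_borel
  by (rule finite_measureI) simp

text \<open>The disk of radius \<open>sqrt x\<close> has normalised area \<open>x\<close>, so \<open>|z|\<^sup>2\<close> is uniformly distributed on the
  unit interval. This reduces radial integrals over the disk to integrals over an interval without
  polar coordinates.\<close>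

lemma distr_disk_borel_cmod_sq:
  "distr disk_borel borel (\<lambda>z. (cmod z)\<^sup>2) = density lborel (\<lambda>t. ennreal (indicator {0..1} t))"
  (is "?M = ?N")
proof (rule measure_eqI_lessThan)
  have le: "emeasure disk_borel {z. (cmod z)\<^sup>2 \<le> x} = ennreal x" if "0 \<le> x" "x \<le> 1" for x
  proof -
    have "{z. (cmod z)\<^sup>2 \<le> x} = cball 0 (sqrt x)"
      using that by (auto simp: real_le_rsqrt sqrt_ge_absD)
    then show ?thesis using that by (simp add: emeasure_disk_borel_cball)
  qed
  fix x :: real
  have M: "emeasure ?M {x<..} = emeasure disk_borel {z. x < (cmod z)\<^sup>2}"
    by (subst emeasure_distr) (auto simp: vimage_def)
  then show "emeasure ?M {x<..} < \<infinity>" by (simp add: less_top[symmetric])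
  have N: "emeasure ?N {x<..} = emeasure lborel ({0..1} \<inter> {x<..})"
    by (subst emeasure_density)
       (auto simp: indicator_inter_arith simp flip: ennreal_indicator ennreal_mult nn_integral_indicator)
  consider "x < 0" | "0 \<le> x" "x \<le> 1" | "x > 1" by linarith
  then show "emeasure ?M {x<..} = emeasure ?N {x<..}"
  proof cases
    case 1
    then have "{z. x < (cmod z)\<^sup>2} = UNIV" by (auto intro: less_le_trans)
    moreover from 1 have "{0..1} \<inter> {x<..} = {0..1::real}" by auto
    ultimately show ?thesis unfolding M N by simp
  next
    case 2
    have "{z. x < (cmod z)\<^sup>2} = space disk_borel - {z. (cmod z)\<^sup>2 \<le> x}" by auto
    also have "emeasure disk_borel \<dots> = 1 - ennreal x"
      using le[OF 2] by (subst emeasure_compl) simp_all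
    finally have "emeasure disk_borel {z. x < (cmod z)\<^sup>2} = 1 - ennreal x" .
    moreover from 2 have "{0..1} \<inter> {x<..} = {x<..1}" by auto
    ultimately show ?thesis unfolding M N using 2 by (simp add: ennreal_minus flip: ennreal_1)
  next
    case 3
    have "AE z in disk_borel. \<not> x < (cmod z)\<^sup>2"
      using AE_disk_borel
    proof eventually_elim
      case (elim z)
      then have "(cmod z)\<^sup>2 \<le> 1" by (simp add: power_le_one)
      with 3 show ?case by simp
    qed
    then have "emeasure disk_borel {z. x < (cmod z)\<^sup>2} = 0"
      by (subst AE_iff_measurable[symmetric]) auto
    moreover from 3 have "{0..1} \<inter> {x<..} = {}" by auto
    ultimately show ?thesis unfolding M N by simp
  qed
qed simp_all

text \<open>The moments \<open>\<integral> |z|\<^bsup>2(j+p)\<^esup> dA = 1 / (j + p + 1)\<close>. The integer part of the exponent is kept as an ordinary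
  power because it arises as \<open>z\<^sup>j\<close> times its conjugate.\<close>

lemma integral_disk_borel_powr:
  assumes "p \<ge> 0"
  shows "(LINT z|disk_borel. cmod z ^ (2 * j) * cmod z powr (2 * p)) = 1 / (real j + p + 1)"
proof -
  have pw: "cmod z ^ (2 * j) * cmod z powr (2 * p) = ((cmod z)\<^sup>2) ^ j * ((cmod z)\<^sup>2) powr p" for z
    by (cases "z = 0") (simp_all add: power_mult powr_powr flip: powr_numeral)
  have "(LINT z|disk_borel. cmod z ^ (2 * j) * cmod z powr (2 * p))
      = (LINT t|distr disk_borel borel (\<lambda>z. (cmod z)\<^sup>2). t ^ j * t powr p)"
    unfolding pw by (subst integral_distr) simp_all
  also have "\<dots> = (LINT t|lborel. indicator {0..1} t *\<^sub>R (t ^ j * t powr p))"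
    unfolding distr_disk_borel_cmod_sq by (subst integral_density) simp_all
  also have "\<dots> = 1 / (real j + p + 1)"
  proof (rule has_bochner_integral_integral_eq, rule has_bochner_integral_nn_integral)
    have "((\<lambda>t. t powr (real j + p)) has_integral (1 powr (real j + p + 1) / (real j + p + 1))) {0..1}"
      using assms by (intro has_integral_powr_from_0) auto
    then have h: "((\<lambda>t. indicator {0..1} t * (t ^ j * t powr p)) has_integral (1 / (real j + p + 1))) UNIV"
    \<comment> \<open>The two integrands can differ at 0, because 0 powr 0 is 0 while 0 ^ 0 is 1.\<close>
    proof (subst (asm) has_integral_spike_eq[of "{0}" _ "\<lambda>t. t ^ j * t powr p"])
      show "((\<lambda>t. t ^ j * t powr p) has_integral 1 powr (real j + p + 1) / (real j + p + 1)) {0..1} \<Longrightarrow>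
        ((\<lambda>t. indicator {0..1} t * (t ^ j * t powr p)) has_integral 1 / (real j + p + 1)) UNIV"
        by (subst (asm) has_integral_restrict_UNIV[symmetric])
           (simp add: indicator_def of_bool_def if_distrib[of "\<lambda>x. x * _"] cong: if_cong)
    qed (auto simp: powr_add powr_realpow)
    show "(\<integral>\<^sup>+t. ennreal (indicator {0..1} t *\<^sub>R (t ^ j * t powr p)) \<partial>lborel) = ennreal (1 / (real j + p + 1))"
      unfolding real_scaleR_def by (rule nn_integral_has_integral_lborel[OF _ _ h]) (simp_all add: indicator_def)
  qed (use assms in \<open>auto simp: indicator_def\<close>)
  finally show ?thesis .
qed

lemma distr_disk_borel_rotation:
  assumes u: "cmod u = 1"
  shows "distr disk_borel borel (\<lambda>z. u * z) = disk_borel"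
proof -
  have "disk_borel = density (distr lborel borel (\<lambda>z. u * z)) (\<lambda>z. ennreal (indicator (ball 0 1) z / pi))"
    by (simp add: distr_lborel_rotation[OF u] disk_borel_def)
  also have "\<dots> = distr (density lborel (\<lambda>z. ennreal (indicator (ball 0 1) (u * z) / pi))) borel (\<lambda>z. u * z)"
    by (rule density_distr) simp_all
  also have "(\<lambda>z. ennreal (indicator (ball 0 1) (u * z) / pi)) = (\<lambda>z. ennreal (indicator (ball 0 1) z / pi))"
    using u by (auto simp: fun_eq_iff indicator_def norm_mult)
  finally show ?thesis by (simp add: disk_borel_def)
qed

text \<open>A function may be replaced by its averages over the circles about the origin: rotating by any angle
  does not change the integral, so one integrates over all angles as well and exchanges the order of
  integration. Fubini's theorem applies because the rotated functions all have the same \<open>L\<^sup>1\<close> norm.\<close>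

lemma integral_disk_borel_circle_average:
  fixes F G :: "complex \<Rightarrow> complex"
  assumes int: "integrable disk_borel F" and [measurable]: "G \<in> borel_measurable borel"
    and cont: "\<And>z. cmod z < 1 \<Longrightarrow> continuous_on {0..1} (\<lambda>t. F (cis (2 * pi * t) * z))"
    and avg: "\<And>z. cmod z < 1 \<Longrightarrow> ((\<lambda>t. F (cis (2 * pi * t) * z)) has_integral G z) {0..1}"
  shows "integral\<^sup>L disk_borel F = integral\<^sup>L disk_borel G"
proof -
  define I where "I = restrict_space lborel {0..1::real}"
  have eI: "emeasure I (space I) = 1"
    unfolding I_def by (subst emeasure_restrict_space) (simp_all add: space_restrict_space)
  then interpret I: finite_measure I by (intro finite_measureI) simp
  interpret P: pair_sigma_finite I disk_borel ..
  have F [measurable]: "F \<in> borel_measurable borel"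
    using int by (auto dest: borel_measurable_integrable)
  have [measurable]: "(\<lambda>t. cis (2 * pi * t)) \<in> borel_measurable borel"
    by (intro borel_measurable_continuous_onI continuous_intros)
  have [measurable]: "(\<lambda>t. cis (2 * pi * t)) \<in> borel_measurable I"
    unfolding I_def by (intro measurable_restrict_space1) simp
  have rot: "integrable disk_borel (\<lambda>z. f (u * z)) \<longleftrightarrow> integrable disk_borel f"
       "integral\<^sup>L disk_borel (\<lambda>z. f (u * z)) = integral\<^sup>L disk_borel f"
    if "cmod u = 1" "f \<in> borel_measurable borel" for u and f :: "complex \<Rightarrow> 'x::{banach,second_countable_topology}"
    using that integrable_distr_eq[of "\<lambda>z. u * z" disk_borel borel f]
      integral_distr[of "\<lambda>z. u * z" disk_borel borel f]
    by (simp_all add: distr_disk_borel_rotation)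
  have prod: "integrable (I \<Otimes>\<^sub>M disk_borel) (\<lambda>(t, z). F (cis (2 * pi * t) * z))"
  proof (rule P.Fubini_integrable)
    show "integrable I (\<lambda>t. LINT z|disk_borel. norm (case (t, z) of (t, z) \<Rightarrow> F (cis (2 * pi * t) * z)))"
      using rot(2)[of _ "\<lambda>z. norm (F z)"] by simp
    show "AE t in I. integrable disk_borel (\<lambda>z. case (t, z) of (t, z) \<Rightarrow> F (cis (2 * pi * t) * z))"
      using rot(1)[of _ F] int by simp
  qed simp
  have "integral\<^sup>L disk_borel F = (LINT t|I. LINT z|disk_borel. F (cis (2 * pi * t) * z))"
    using rot(2)[of _ F] eI by (simp add: measure_def)
  also have "\<dots> = (LINT z|disk_borel. LINT t|I. F (cis (2 * pi * t) * z))"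
    using P.Fubini_integral[OF prod] by simp
  also have "\<dots> = integral\<^sup>L disk_borel G"
  proof (rule integral_cong_AE)
    show "AE z in disk_borel. (LINT t|I. F (cis (2 * pi * t) * z)) = G z"
      using AE_disk_borel
    proof eventually_elim
      case (elim z)
      then have z: "cmod z < 1" by simp
      have "(LINT t|I. F (cis (2 * pi * t) * z)) = (LINT t:{0..1}|lborel. F (cis (2 * pi * t) * z))"
        unfolding I_def by (simp add: integral_restrict_space set_lebesgue_integral_def)
      also have "\<dots> = integral {0..1} (\<lambda>t. F (cis (2 * pi * t) * z))"
        by (intro set_borel_integral_eq_integral borel_integrable_atLeastAtMost' cont z)
      also have "\<dots> = G z" by (rule integral_unique[OF avg[OF z]])
      finally show ?case .
    qed
  qed measurable
  finally show ?thesis .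
qed

section \<open>Inner products of radially weighted monomials with Bergman functions\<close>

definition taylor_coeff :: "(complex \<Rightarrow> complex) \<Rightarrow> nat \<Rightarrow> complex" where
  "taylor_coeff h j = (deriv ^^ j) h 0 / fact j"

text \<open>The mean of \<open>h\<close> over the circle through \<open>z\<close>, twisted by the character \<open>j\<close>, isolates the term of degree \<open>j\<close> of
  the Taylor series. Starting the circle at \<open>z\<close> rather than at \<open>|z|\<close> avoids polar coordinates: one
  applies Cauchy's formula on the unit circle to the function sending \<open>u\<close> to \<open>h (z u)\<close>.\<close>

lemma has_integral_circle_taylor_coeff:
  assumes h: "h holomorphic_on ball 0 1" and z: "cmod z < 1"
  shows "((\<lambda>t. cnj (cis (2 * pi * t) ^ j) * h (cis (2 * pi * t) * z)) has_integral
          z ^ j * taylor_coeff h j) {0..1}"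
proof -
  define H where "H = (\<lambda>u. h (z * u))"
  have sub: "(\<lambda>u. z * u) ` cball 0 1 \<subseteq> ball 0 1"
  proof clarsimp
    fix u :: complex assume "cmod u \<le> 1"
    then have "cmod z * cmod u \<le> cmod z" by (simp add: mult_left_le)
    with z show "cmod (z * u) < 1" by (simp add: norm_mult)
  qed
  have cont: "continuous_on (cball 0 1) H" unfolding H_def
    by (rule continuous_on_compose2[OF holomorphic_on_imp_continuous_on[OF h] _ sub])
       (intro continuous_intros)
  have "(\<lambda>u. z * u) ` ball 0 1 \<subseteq> ball 0 1" using sub ball_subset_cball by blast
  then have hol: "H holomorphic_on ball 0 1" unfolding H_def
    using holomorphic_on_compose_gen[of "\<lambda>u. z * u" "ball 0 1" h "ball 0 1"] h
    by (auto simp: comp_def intro!: holomorphic_intros)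
  have "((\<lambda>u. H u / (u - 0) ^ Suc j) has_contour_integral
         (2 * pi * \<i>) / fact j * (deriv ^^ j) H 0) (circlepath 0 1)"
    by (rule Cauchy_has_contour_integral_higher_derivative_circlepath[OF cont hol]) simp
  moreover have "z * w \<in> ball 0 1" if "w \<in> ball 0 1" for w
    using \<open>(\<lambda>u. z * u) ` ball 0 1 \<subseteq> ball 0 1\<close> that by blast
  then have "(deriv ^^ j) H 0 = z ^ j * (deriv ^^ j) h 0" unfolding H_def
    using higher_deriv_compose_linear[OF h open_ball[of 0 1] open_ball, where z = 0 and u = z and n = j]
    by simp
  ultimately have *: "((\<lambda>t. H (circlepath 0 1 t) / circlepath 0 1 t ^ Suc j * (2 * pi * \<i> * exp (2 * pi * \<i> * t)))
      has_integral (2 * pi * \<i>) * (z ^ j * taylor_coeff h j)) {0..1}"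
    by (simp add: has_contour_integral vector_derivative_circlepath taylor_coeff_def)
  define c :: complex where "c = 2 * pi * \<i>"
  have c0: "c \<noteq> 0" by (simp add: c_def)
  note *
  then have "((\<lambda>t. c * (cnj (cis (2 * pi * t) ^ j) * h (cis (2 * pi * t) * z)))
      has_integral c * (z ^ j * taylor_coeff h j)) {0..1}"
    unfolding c_def[symmetric]
  proof (rule has_integral_eq[rotated])
    fix t :: real
    have e: "exp (c * t) = cis (2 * pi * t)" by (simp add: c_def cis_conv_exp mult_ac)
    have c: "circlepath 0 1 t = cis (2 * pi * t)" by (simp add: circlepath cis_conv_exp mult_ac)
    have "cnj (cis (2 * pi * t) ^ j) = 1 / cis (2 * pi * t) ^ j"
      by (simp add: cis_cnj inverse_eq_divide[symmetric] power_inverse flip: cis_inverse)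
    then show "H (circlepath 0 1 t) / circlepath 0 1 t ^ Suc j * (c * exp (c * t))
      = c * (cnj (cis (2 * pi * t) ^ j) * h (cis (2 * pi * t) * z))"
      unfolding e c H_def by (simp add: mult_ac)
  qed
  from has_integral_mult_right[OF this, of "inverse c"] show ?thesis
    using c0 by (simp add: mult.assoc[symmetric])
qed

lemma borel_measurable_cnj [measurable]: "cnj \<in> borel_measurable borel"
  by (intro borel_measurable_continuous_onI continuous_intros)

lemma borel_measurable_bergman [measurable_dest]:
  assumes "h \<in> bergman"
  shows "h \<in> borel_measurable borel"
proof -
  have "continuous_on (ball 0 1) h"
    using assms by (auto simp: bergman_def intro: holomorphic_on_imp_continuous_on)
  then have "(\<lambda>z. indicator (ball 0 1) z *\<^sub>R h z) \<in> borel_measurable borel"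
    by (rule borel_measurable_continuous_on_indicator[rotated]) simp
  also have "(\<lambda>z. indicator (ball 0 1) z *\<^sub>R h z) = h"
    using assms by (auto simp: bergman_def indicator_def fun_eq_iff)
  finally show ?thesis .
qed

text \<open>Products with the symbol of a Toeplitz operator leave the Bergman space; linearity of the inner
  product is therefore set up on this larger class. Borel measurability, rather than Lebesgue
  measurability, keeps the transfer to \<open>disk_borel\<close> available.\<close>

definition square_integrable :: "(complex \<Rightarrow> complex) \<Rightarrow> bool" where
  "square_integrable f \<longleftrightarrow> f \<in> borel_measurable borel \<and> integrable disk_area (\<lambda>z. (cmod (f z))\<^sup>2)"

lemma bergman_square_integrable: "h \<in> bergman \<Longrightarrow> square_integrable h"
  by (simp add: square_integrable_def borel_measurable_bergman) (simp add: bergman_def)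

lemma square_integrable_borel [measurable_dest]:
  "square_integrable f \<Longrightarrow> f \<in> borel_measurable borel"
  by (simp add: square_integrable_def)

lemma square_integrable_mult_bounded:
  assumes f: "square_integrable f" and [measurable]: "w \<in> borel_measurable borel"
    and b: "\<And>z. cmod z < 1 \<Longrightarrow> cmod (w z) \<le> C"
  shows "square_integrable (\<lambda>z. w z * f z)"
proof -
  note [measurable] = square_integrable_borel[OF f]
  have "integrable disk_area (\<lambda>z. C\<^sup>2 * (cmod (f z))\<^sup>2)"
    using f by (simp add: square_integrable_def)
  then have "integrable disk_area (\<lambda>z. (cmod (w z * f z))\<^sup>2)"
  proof (rule Bochner_Integration.integrable_bound)
    show "AE z in disk_area. norm ((cmod (w z * f z))\<^sup>2) \<le> norm (C\<^sup>2 * (cmod (f z))\<^sup>2)"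
    proof (rule AE_I2)
      fix z assume "z \<in> space disk_area"
      then have "cmod (w z) \<le> C" using b by simp
      then have "(cmod (w z))\<^sup>2 \<le> C\<^sup>2" by (intro power_mono) auto
      then show "norm ((cmod (w z * f z))\<^sup>2) \<le> norm (C\<^sup>2 * (cmod (f z))\<^sup>2)"
        by (simp add: norm_mult power_mult_distrib mult_right_mono)
    qed
  qed (simp add: borel_measurable_disk_area)
  then show ?thesis by (simp add: square_integrable_def)
qed

lemma integrable_disk_inner:
  assumes f: "square_integrable f" and g: "square_integrable g"
  shows "integrable disk_area (\<lambda>z. f z * cnj (g z))"
proof -
  note [measurable] = square_integrable_borel[OF f] square_integrable_borel[OF g]
  have "integrable disk_area (\<lambda>z. (cmod (f z))\<^sup>2 + (cmod (g z))\<^sup>2)"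
    using f g by (simp add: square_integrable_def)
  then show ?thesis
  proof (rule Bochner_Integration.integrable_bound)
    show "AE z in disk_area. norm (f z * cnj (g z)) \<le> norm ((cmod (f z))\<^sup>2 + (cmod (g z))\<^sup>2)"
    proof (rule AE_I2)
      fix z
      have "2 * (cmod (f z) * cmod (g z)) \<le> (cmod (f z))\<^sup>2 + (cmod (g z))\<^sup>2"
        using sum_squares_bound[of "cmod (f z)" "cmod (g z)"] by simp
      moreover have "0 \<le> cmod (f z) * cmod (g z)" by simp
      ultimately have "cmod (f z) * cmod (g z) \<le> (cmod (f z))\<^sup>2 + (cmod (g z))\<^sup>2"
        by linarith
      then show "norm (f z * cnj (g z)) \<le> norm ((cmod (f z))\<^sup>2 + (cmod (g z))\<^sup>2)"
        by (simp add: norm_mult)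
    qed
  qed (simp add: borel_measurable_disk_area)
qed

lemma square_integrable_add:
  assumes f: "square_integrable f" and g: "square_integrable g"
  shows "square_integrable (\<lambda>z. f z + g z)"
proof -
  note [measurable] = square_integrable_borel[OF f] square_integrable_borel[OF g]
  have "integrable disk_area (\<lambda>z. 2 * (cmod (f z))\<^sup>2 + 2 * (cmod (g z))\<^sup>2)"
    using f g by (simp add: square_integrable_def)
  then have "integrable disk_area (\<lambda>z. (cmod (f z + g z))\<^sup>2)"
  proof (rule Bochner_Integration.integrable_bound)
    show "AE z in disk_area. norm ((cmod (f z + g z))\<^sup>2) \<le> norm (2 * (cmod (f z))\<^sup>2 + 2 * (cmod (g z))\<^sup>2)"
    proof (rule AE_I2)
      fix z
      have "(cmod (f z + g z))\<^sup>2 \<le> (cmod (f z) + cmod (g z))\<^sup>2"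
        by (intro power_mono norm_triangle_ineq) auto
      also have "\<dots> \<le> 2 * (cmod (f z))\<^sup>2 + 2 * (cmod (g z))\<^sup>2"
        using sum_squares_bound[of "cmod (f z)" "cmod (g z)"] by (simp add: power2_sum)
      finally show "norm ((cmod (f z + g z))\<^sup>2) \<le> norm (2 * (cmod (f z))\<^sup>2 + 2 * (cmod (g z))\<^sup>2)"
        by simp
    qed
  qed (simp add: borel_measurable_disk_area)
  then show ?thesis by (simp add: square_integrable_def)
qed

lemma square_integrable_cmult:
  "square_integrable f \<Longrightarrow> square_integrable (\<lambda>z. c * f z)"
  by (rule square_integrable_mult_bounded[where C = "cmod c"]) simp_all

lemma of_real_cmod_even_power: "complex_of_real (cmod z ^ (2 * j)) = z ^ j * cnj z ^ j"
proof -
  have "complex_of_real (cmod z ^ (2 * j)) = of_real ((cmod z)\<^sup>2) ^ j" by (simp add: power_mult)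
  then show ?thesis unfolding complex_norm_square by (simp add: power_mult_distrib)
qed

text \<open>Rotating \<open>z\<close> by an angle multiplies the function \<open>z\<^sup>j w(|z|)\<close> by the character \<open>j\<close>, so averaging over
  circles replaces \<open>h\<close> by its Taylor term of degree \<open>j\<close>. In contrast to a termwise integration of the Taylor series, this needs no convergence
  in the Bergman space.\<close>

lemma disk_inner_radial:
  fixes w :: "real \<Rightarrow> real"
  assumes h: "h \<in> bergman" and [measurable]: "w \<in> borel_measurable borel"
    and b: "\<And>r. 0 \<le> r \<Longrightarrow> r < 1 \<Longrightarrow> \<bar>w r\<bar> \<le> 1"
  shows "disk_inner (\<lambda>z. z ^ j * of_real (w (cmod z))) h
      = cnj (taylor_coeff h j) * of_real (LINT z|disk_borel. cmod z ^ (2 * j) * w (cmod z))"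
proof -
  note [measurable] = borel_measurable_bergman[OF h]
  have hol: "h holomorphic_on ball 0 1" using h by (simp add: bergman_def)
  \<comment> \<open>\<open>F\<close> is the complex conjugate of the integrand, so that it contains \<open>h\<close> and not its conjugate.\<close>
  define F where "F = (\<lambda>z. of_real (w (cmod z)) * cnj (z ^ j) * h z)"
  define G where "G = (\<lambda>z. of_real (cmod z ^ (2 * j) * w (cmod z)) * taylor_coeff h j)"
  have one: "square_integrable (\<lambda>_. 1)"
    by (simp add: square_integrable_def integrable_disk_area)
  have "square_integrable (\<lambda>z. (z ^ j * of_real (w (cmod z))) * 1)"
  proof (rule square_integrable_mult_bounded[OF one, where C = 1])
    fix z :: complex assume "cmod z < 1"
    then show "cmod (z ^ j * of_real (w (cmod z))) \<le> 1"
      using b[of "cmod z"] by (simp add: norm_mult norm_power mult_le_one power_le_one)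
  qed simp
  then have "integrable disk_area (\<lambda>z. h z * cnj (z ^ j * of_real (w (cmod z))))"
    using integrable_disk_inner bergman_square_integrable[OF h] by fastforce
  then have "integrable disk_borel F"
    by (subst (asm) integrable_disk_area) (simp_all add: F_def mult_ac)
  then have "integral\<^sup>L disk_borel F = integral\<^sup>L disk_borel G"
  proof (rule integral_disk_borel_circle_average)
    show "G \<in> borel_measurable borel" unfolding G_def by measurable
    fix z :: complex assume z: "cmod z < 1"
    have Fz: "F (cis (2 * pi * t) * z) = (of_real (w (cmod z)) * cnj (z ^ j)) *
       (cnj (cis (2 * pi * t) ^ j) * h (cis (2 * pi * t) * z))" for t
      by (simp add: F_def norm_mult power_mult_distrib mult_ac)
    have sub: "(\<lambda>t. cis (2 * pi * t) * z) ` {0..1} \<subseteq> ball 0 1"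
      using z by (auto simp: norm_mult)
    show "continuous_on {0..1} (\<lambda>t. F (cis (2 * pi * t) * z))"
      unfolding Fz
      by (intro continuous_intros continuous_on_compose2[OF holomorphic_on_imp_continuous_on[OF hol] _ sub])
    have "G z = of_real (w (cmod z)) * cnj (z ^ j) * (z ^ j * taylor_coeff h j)"
      unfolding G_def of_real_mult of_real_cmod_even_power by simp
    then show "((\<lambda>t. F (cis (2 * pi * t) * z)) has_integral G z) {0..1}"
      unfolding Fz using has_integral_mult_right[OF has_integral_circle_taylor_coeff[OF hol z]] by simp
  qed
  also have "\<dots> = of_real (LINT z|disk_borel. cmod z ^ (2 * j) * w (cmod z)) * taylor_coeff h j"
    unfolding G_def by (simp del: of_real_mult of_real_power)
  finally have *: "cnj (integral\<^sup>L disk_borel F)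
     = cnj (taylor_coeff h j) * of_real (LINT z|disk_borel. cmod z ^ (2 * j) * w (cmod z))"
    by simp
  have "disk_inner (\<lambda>z. z ^ j * of_real (w (cmod z))) h
     = (LINT z|disk_borel. cnj (F z))"
    unfolding disk_inner_def by (subst integral_disk_area) (simp_all add: F_def mult_ac)
  also have "\<dots> = cnj (integral\<^sup>L disk_borel F)" by simp
  finally show ?thesis using * by simp
qed

section \<open>The monomials in the Bergman space\<close>

lemma integral_disk_borel_power: "(LINT z|disk_borel. cmod z ^ (2 * j)) = 1 / (real j + 1)"
proof (cases "j = 0")
  case True
  then show ?thesis by (simp add: measure_def)
next
  case False
  then have "(\<lambda>z. cmod z ^ (2 * j) * cmod z powr (2 * 0)) = (\<lambda>z. cmod z ^ (2 * j))"
    by (auto simp: fun_eq_iff)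
  with integral_disk_borel_powr[of 0 j] show ?thesis by (simp only: order_refl) simp
qed

lemma disk_inner_cong:
  "(\<And>z. cmod z < 1 \<Longrightarrow> f z = f' z) \<Longrightarrow> (\<And>z. cmod z < 1 \<Longrightarrow> g z = g' z) \<Longrightarrow>
    disk_inner f g = disk_inner f' g'"
  unfolding disk_inner_def by (intro Bochner_Integration.integral_cong) auto

lemma disk_inner_commute: "disk_inner f g = cnj (disk_inner g f)"
  unfolding disk_inner_def by (subst Bochner_Integration.integral_cnj[symmetric]) (simp add: mult.commute)

lemma disk_inner_add_left:
  "square_integrable f \<Longrightarrow> square_integrable g \<Longrightarrow> square_integrable h \<Longrightarrow>
    disk_inner (\<lambda>z. f z + g z) h = disk_inner f h + disk_inner g h"
  unfolding disk_inner_def by (simp add: distrib_right integrable_disk_inner)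

lemma disk_inner_diff_left:
  "square_integrable f \<Longrightarrow> square_integrable g \<Longrightarrow> square_integrable h \<Longrightarrow>
    disk_inner (\<lambda>z. f z - g z) h = disk_inner f h - disk_inner g h"
  unfolding disk_inner_def by (simp add: left_diff_distrib integrable_disk_inner)

lemma disk_inner_cmult_left: "disk_inner (\<lambda>z. c * f z) g = c * disk_inner f g"
  unfolding disk_inner_def by (simp add: mult.assoc)

lemma disk_inner_add_right:
  "square_integrable f \<Longrightarrow> square_integrable g \<Longrightarrow> square_integrable h \<Longrightarrow>
    disk_inner h (\<lambda>z. f z + g z) = disk_inner h f + disk_inner h g"
  unfolding disk_inner_def by (simp add: distrib_left integrable_disk_inner)

lemma disk_inner_cmult_right: "disk_inner f (\<lambda>z. c * g z) = cnj c * disk_inner f g"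
  unfolding disk_inner_def by (simp add: mult.left_commute)

lemma bergman_add: "f \<in> bergman \<Longrightarrow> g \<in> bergman \<Longrightarrow> (\<lambda>z. f z + g z) \<in> bergman"
  using square_integrable_add[OF bergman_square_integrable bergman_square_integrable, of f g]
  by (auto simp: bergman_def square_integrable_def intro!: holomorphic_intros)

lemma bergman_cmult: "f \<in> bergman \<Longrightarrow> (\<lambda>z. c * f z) \<in> bergman"
  using square_integrable_cmult[OF bergman_square_integrable, of f c]
  by (auto simp: bergman_def square_integrable_def intro!: holomorphic_intros)

lemma bergman_power_mult: 
  assumes "f \<in> bergman" shows "(\<lambda>z. z ^ m * f z) \<in> bergman"
proof -
  have "square_integrable (\<lambda>z. z ^ m * f z)"
    using assms by (intro square_integrable_mult_bounded[where C = 1] bergman_square_integrable)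
      (auto simp: norm_power power_le_one)
  with assms show ?thesis
    by (auto simp: bergman_def square_integrable_def intro!: holomorphic_intros)
qed

text \<open>Cut off outside the disk, as membership in \<open>bergman\<close> demands.\<close>

definition disk_monomial :: "nat \<Rightarrow> complex \<Rightarrow> complex" where
  "disk_monomial k z = (if cmod z < 1 then z ^ k else 0)"

lemma disk_monomial_bergman: "disk_monomial k \<in> bergman"
proof -
  have [measurable]: "disk_monomial k \<in> borel_measurable borel"
    unfolding disk_monomial_def by measurable
  have "disk_monomial k holomorphic_on ball 0 1 \<longleftrightarrow> (\<lambda>z. z ^ k) holomorphic_on ball 0 1"
    by (rule holomorphic_cong) (auto simp: disk_monomial_def)
  then have "disk_monomial k holomorphic_on ball 0 1" by (simp add: holomorphic_intros)
  moreover have "integrable disk_area (\<lambda>z. (cmod (disk_monomial k z))\<^sup>2)"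
  proof (subst integrable_disk_area)
    show "integrable disk_borel (\<lambda>z. (cmod (disk_monomial k z))\<^sup>2)"
      by (rule disk_borel.integrable_const_bound[where B = 1])
         (auto simp: disk_monomial_def norm_power power_le_one)
  qed measurable
  ultimately show ?thesis by (auto simp: bergman_def disk_monomial_def)
qed

lemma taylor_coeff_disk_monomial: "taylor_coeff (disk_monomial k) j = (if j = k then 1 else 0)"
proof -
  have "(deriv ^^ j) (disk_monomial k) 0 = (deriv ^^ j) (\<lambda>z. (z - 0) ^ k) 0"
    using disk_monomial_bergman[of k]
    by (intro higher_deriv_transform_within_open[where S = "ball 0 1"])
       (auto simp: bergman_def disk_monomial_def intro!: holomorphic_intros)
  also have "\<dots> = (if j = k then fact j else 0)"
  proof -
    consider "j < k" | "j = k" | "j > k" by linarith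
    then show ?thesis unfolding higher_deriv_power
      by cases (auto simp: pochhammer_fact pochhammer_0_left)
  qed
  finally show ?thesis by (simp add: taylor_coeff_def)
qed

lemma disk_inner_power_radial:
  assumes h: "h \<in> bergman"
  shows "disk_inner (\<lambda>z. z ^ j * of_real (cmod z ^ (2 * m))) h = cnj (taylor_coeff h j) / of_nat (j + m + 1)"
proof -
  have "disk_inner (\<lambda>z. z ^ j * of_real (cmod z ^ (2 * m))) h
     = cnj (taylor_coeff h j) * of_real (LINT z|disk_borel. cmod z ^ (2 * j) * cmod z ^ (2 * m))"
    by (rule disk_inner_radial[OF h]) (auto simp: power_le_one)
  also have "(\<lambda>z::complex. cmod z ^ (2 * j) * cmod z ^ (2 * m)) = (\<lambda>z. cmod z ^ (2 * (j + m)))"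
    by (simp add: power_add distrib_left)
  finally show ?thesis unfolding integral_disk_borel_power by simp
qed

lemma disk_inner_power_powr:
  assumes h: "h \<in> bergman" and "p \<ge> 0"
  shows "disk_inner (\<lambda>z. z ^ j * of_real (cmod z powr (2 * p))) h
      = cnj (taylor_coeff h j) / of_real (real j + p + 1)"
proof -
  have "disk_inner (\<lambda>z. z ^ j * of_real (cmod z powr (2 * p))) h
     = cnj (taylor_coeff h j) * of_real (LINT z|disk_borel. cmod z ^ (2 * j) * cmod z powr (2 * p))"
    using \<open>p \<ge> 0\<close> by (intro disk_inner_radial[OF h]) (auto intro: powr_le1)
  then show ?thesis using \<open>p \<ge> 0\<close> by (simp add: integral_disk_borel_powr)
qed

lemma disk_inner_monomial_left:
  assumes h: "h \<in> bergman"
  shows "disk_inner (disk_monomial j) h = cnj (taylor_coeff h j) / of_nat (j + 1)"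
proof -
  have "disk_inner (disk_monomial j) h = disk_inner (\<lambda>z. z ^ j * of_real (cmod z ^ (2 * 0))) h"
    by (rule disk_inner_cong) (simp_all add: disk_monomial_def)
  then show ?thesis using disk_inner_power_radial[OF h, of j 0] by simp
qed

lemma disk_inner_monomials:
  "disk_inner (disk_monomial j) (disk_monomial k) = (if j = k then 1 / of_nat (k + 1) else 0)"
  by (simp add: disk_inner_monomial_left disk_monomial_bergman taylor_coeff_disk_monomial)

text \<open>Up to a nonzero factor, the inner products with the monomials are the Taylor coefficients, and these
  determine a holomorphic function on the disk.\<close>

lemma bergman_eqI:
  assumes p: "p \<in> bergman" and q: "q \<in> bergman"
    and eq: "\<And>j. disk_inner (disk_monomial j) p = disk_inner (disk_monomial j) q"
  shows "p = q"
proof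
  fix z
  have "cnj (taylor_coeff p j) = cnj (taylor_coeff q j)" for j
    using eq[of j] by (simp add: disk_inner_monomial_left p q del: of_nat_add of_nat_Suc)
  then have "(deriv ^^ j) p 0 = (deriv ^^ j) q 0" for j by (simp add: taylor_coeff_def)
  then have "p z = q z" if "z \<in> ball 0 1"
    using p q that by (intro holomorphic_fun_eq_on_ball[of p 0 1 q]) (auto simp: bergman_def)
  then show "p z = q z" using p q by (cases "z \<in> ball 0 1") (auto simp: bergman_def)
qed

text \<open>The uniqueness required by the definite description holds because two candidates have the same inner
  products with all monomials.\<close>

lemma bergman_proj_eqI:
  assumes f: "square_integrable f" and p: "p \<in> bergman"
    and eq: "\<And>h. h \<in> bergman \<Longrightarrow> disk_inner f h = disk_inner p h"
  shows "bergman_proj f = p"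
  unfolding bergman_proj_def
proof (rule the_equality)
  note si = bergman_square_integrable
  show "p \<in> bergman \<and> (\<forall>h\<in>bergman. disk_inner (\<lambda>z. f z - p z) h = 0)"
    using p f by (simp add: disk_inner_diff_left si eq)
  fix q assume q: "q \<in> bergman \<and> (\<forall>h\<in>bergman. disk_inner (\<lambda>z. f z - q z) h = 0)"
  have "disk_inner p h = disk_inner q h" if "h \<in> bergman" for h
  proof -
    have "disk_inner (\<lambda>z. f z - q z) h = disk_inner f h - disk_inner q h"
      using q f that by (intro disk_inner_diff_left) (auto intro: si)
    with q that show ?thesis by (simp flip: eq)
  qed
  then show "q = p"
    using p q disk_monomial_bergman by (intro bergman_eqI) (metis disk_inner_commute)+
qed

lemma square_integrable_bounded:
  assumes [measurable]: "F \<in> borel_measurable borel" and b: "\<And>z. cmod z < 1 \<Longrightarrow> cmod (F z) \<le> C"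
  shows "square_integrable F"
proof -
  have "square_integrable (\<lambda>_. 1)"
    by (simp add: square_integrable_def integrable_disk_area)
  from square_integrable_mult_bounded[OF this assms(1) b] show ?thesis by simp
qed

lemma disk_inner_monomial_combination_left:
  assumes "h \<in> bergman"
  shows "disk_inner (\<lambda>z. \<alpha> * disk_monomial i z + \<beta> * disk_monomial j z) h
    = \<alpha> * disk_inner (disk_monomial i) h + \<beta> * disk_inner (disk_monomial j) h"
  using assms by (simp add: disk_inner_add_left disk_inner_cmult_left bergman_square_integrable
      bergman_cmult disk_monomial_bergman)

lemma disk_inner_monomial_combination_self:
  assumes "i \<noteq> j"
  shows "disk_inner (\<lambda>z. \<alpha> * disk_monomial i z + \<beta> * disk_monomial j z)
      (\<lambda>z. \<alpha> * disk_monomial i z + \<beta> * disk_monomial j z)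
    = of_real ((cmod \<alpha>)\<^sup>2 / real (i + 1) + (cmod \<beta>)\<^sup>2 / real (j + 1))"
proof -
  have "(\<lambda>z. \<alpha> * disk_monomial i z + \<beta> * disk_monomial j z) \<in> bergman"
    by (intro bergman_add bergman_cmult disk_monomial_bergman)
  then show ?thesis
    using assms unfolding of_real_add of_real_divide complex_norm_square of_real_of_nat_eq
    by (simp add: disk_inner_monomial_combination_left disk_inner_add_right
      disk_inner_cmult_right disk_inner_monomials bergman_square_integrable
      bergman_cmult disk_monomial_bergman del: of_nat_add of_nat_Suc)
qed

section \<open>Bessel's inequality and hyponormality\<close>

text \<open>One Gram--Schmidt step: \<open>q\<close> is \<open>r\<close> minus its component along the monomial of degree \<open>i\<close>, whose squared
  norm is \<open>1 / (i + 1)\<close>. The other monomial coefficients do not change, so the step can be repeated.\<close>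

lemma split_off_monomial:
  assumes r: "r \<in> bergman"
  obtains q where "q \<in> bergman" "\<And>j. j \<noteq> i \<Longrightarrow> disk_inner (disk_monomial j) q = disk_inner (disk_monomial j) r"
    "Re (disk_inner r r) = real (i + 1) * (cmod (disk_inner (disk_monomial i) r))\<^sup>2 + Re (disk_inner q q)"
proof
  define c where "c = of_nat (i + 1) * disk_inner r (disk_monomial i)"
  define q where "q = (\<lambda>z. r z + (- c) * disk_monomial i z)"
  show q: "q \<in> bergman" unfolding q_def
    by (intro bergman_add bergman_cmult disk_monomial_bergman r)
  note b = bergman_square_integrable bergman_cmult disk_monomial_bergman r q
  have e: "disk_inner (disk_monomial j) q = disk_inner (disk_monomial j) r
      - cnj c * disk_inner (disk_monomial j) (disk_monomial i)" for j
    unfolding q_def by (simp only: disk_inner_add_right disk_inner_cmult_right b) simp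
  then show "disk_inner (disk_monomial j) q = disk_inner (disk_monomial j) r" if "j \<noteq> i" for j
    using that by (simp add: disk_inner_monomials)
  have z: "disk_inner (disk_monomial i) q = 0"
    unfolding e by (simp add: disk_inner_monomials c_def disk_inner_commute[of r] del: of_nat_add of_nat_Suc)
  then have z': "disk_inner q (disk_monomial i) = 0"
    by (subst disk_inner_commute) simp
  have rq: "r = (\<lambda>z. q z + c * disk_monomial i z)" by (simp add: q_def)
  have "disk_inner r r = disk_inner q r + c * disk_inner (disk_monomial i) r"
    by (subst (1) rq) (simp add: disk_inner_add_left disk_inner_cmult_left b)
  also have "disk_inner q r = disk_inner q q"
    by (subst (1) rq) (simp add: disk_inner_add_right disk_inner_cmult_right b z')
  also have "c * disk_inner (disk_monomial i) r
     = of_real (real (i + 1) * (cmod (disk_inner (disk_monomial i) r))\<^sup>2)"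
    unfolding c_def disk_inner_commute[of r] of_real_mult complex_norm_square by simp
  finally show "Re (disk_inner r r) = real (i + 1) * (cmod (disk_inner (disk_monomial i) r))\<^sup>2 + Re (disk_inner q q)"
    by simp
qed

lemma disk_inner_self_nonneg: "0 \<le> Re (disk_inner f f)"
proof -
  have "disk_inner f f = of_real (LINT z|disk_area. (cmod (f z))\<^sup>2)"
    unfolding disk_inner_def complex_norm_square[symmetric] by (rule integral_complex_of_real)
  then show ?thesis by simp
qed

lemma bessel_inequality_pair:
  assumes r: "r \<in> bergman" and ij: "i \<noteq> j"
  shows "real (i + 1) * (cmod (disk_inner (disk_monomial i) r))\<^sup>2
       + real (j + 1) * (cmod (disk_inner (disk_monomial j) r))\<^sup>2 \<le> Re (disk_inner r r)"
proof -
  obtain q where q: "q \<in> bergman" "disk_inner (disk_monomial j) q = disk_inner (disk_monomial j) r"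
    "Re (disk_inner r r) = real (i + 1) * (cmod (disk_inner (disk_monomial i) r))\<^sup>2 + Re (disk_inner q q)"
    using split_off_monomial[OF r, of i] ij by metis
  obtain q' where "Re (disk_inner q q)
      = real (j + 1) * (cmod (disk_inner (disk_monomial j) q))\<^sup>2 + Re (disk_inner q' q')"
    using split_off_monomial[OF q(1), of j] by metis
  then show ?thesis using q(2,3) disk_inner_self_nonneg[of q'] by simp
qed

text \<open>Positivity of \<open>T\<^sup>* T - T T\<^sup>*\<close> says that \<open>\<parallel>T\<^sup>* f\<parallel> \<le> \<parallel>T f\<parallel>\<close> for all \<open>f\<close>; here \<open>S\<close> is the adjoint.\<close>

lemma hyponormal_norm_le:
  assumes "hyponormal T"
  obtains S where "\<And>f. f \<in> bergman \<Longrightarrow> S f \<in> bergman"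
    "\<And>f g. f \<in> bergman \<Longrightarrow> g \<in> bergman \<Longrightarrow> disk_inner (T f) g = disk_inner f (S g)"
    "\<And>f. f \<in> bergman \<Longrightarrow> Re (disk_inner (S f) (S f)) \<le> Re (disk_inner (T f) (T f))"
proof -
  have T: "T f \<in> bergman" if "f \<in> bergman" for f
    using assms that unfolding hyponormal_def bounded_operator_def by blast
  from assms obtain S where "is_adjoint T S" and "positive_operator (\<lambda>f z. S (T f) z - T (S f) z)"
    unfolding hyponormal_def by blast
  then have S: "\<And>f. f \<in> bergman \<Longrightarrow> S f \<in> bergman"
    and adj: "\<And>f g. f \<in> bergman \<Longrightarrow> g \<in> bergman \<Longrightarrow> disk_inner (T f) g = disk_inner f (S g)"
    and pos: "\<And>f. f \<in> bergman \<Longrightarrow> disk_inner (\<lambda>z. S (T f) z - T (S f) z) f \<in> \<real>\<^sub>\<ge>\<^sub>0"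
    unfolding is_adjoint_def positive_operator_def by blast+
  have "Re (disk_inner (S f) (S f)) \<le> Re (disk_inner (T f) (T f))" if f: "f \<in> bergman" for f
  proof -
    have "disk_inner (\<lambda>z. S (T f) z - T (S f) z) f = disk_inner (S (T f)) f - disk_inner (T (S f)) f"
      using f by (intro disk_inner_diff_left bergman_square_integrable S T)
    moreover have "disk_inner (S (T f)) f = cnj (disk_inner (T f) (T f))"
      using f by (subst disk_inner_commute) (simp add: adj T)
    moreover have "disk_inner (T (S f)) f = disk_inner (S f) (S f)"
      using f by (simp add: adj S)
    ultimately show ?thesis using pos[OF f] by (auto simp: complex_nonneg_Reals_iff)
  qed
  with S adj show ?thesis using that by blast
qed

section \<open>The Toeplitz operator on monomials\<close>

text \<open>The two summands of the symbol act separately. The function \<open>v\<close> stands for the projection of the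
  conjugate of \<open>z\<^sup>m\<close> times the monomial, whose form depends on whether \<open>k\<close> is smaller than \<open>m\<close>.\<close>

lemma toeplitz_monomial:
  fixes s :: real
  assumes s: "0 \<le> s" and v: "v \<in> bergman"
    and eq: "\<And>h. h \<in> bergman \<Longrightarrow> disk_inner (\<lambda>z. cnj z ^ m * disk_monomial k z) h = disk_inner v h"
  shows "toeplitz (\<lambda>z. z ^ n * of_real (cmod z powr (2 * s)) + a * cnj z ^ m) (disk_monomial k)
    = (\<lambda>z. of_real (real (n + k + 1) / (real (n + k) + s + 1)) * disk_monomial (n + k) z + a * v z)"
proof -
  let ?f = "\<lambda>z::complex. z ^ (n + k) * of_real (cmod z powr (2 * s))"
  let ?g = "\<lambda>z. cnj z ^ m * disk_monomial k z"
  let ?\<alpha> = "complex_of_real (real (n + k + 1) / (real (n + k) + s + 1))"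
  have f: "square_integrable ?f"
  proof (rule square_integrable_bounded[where C = 1])
    fix z :: complex assume "cmod z < 1"
    then show "cmod (?f z) \<le> 1"
      using s by (simp add: norm_mult norm_power mult_le_one power_le_one powr_le1)
  qed measurable
  have g: "square_integrable ?g"
    by (rule square_integrable_mult_bounded[where C = 1])
       (auto simp: bergman_square_integrable disk_monomial_bergman norm_power power_le_one)
  have ag: "square_integrable (\<lambda>z. a * ?g z)" using g by (rule square_integrable_cmult)
  have [measurable]: "disk_monomial k \<in> borel_measurable borel"
    by (rule borel_measurable_bergman[OF disk_monomial_bergman])
  note b = bergman_square_integrable bergman_cmult disk_monomial_bergman v
  show ?thesis unfolding toeplitz_def
  proof (rule bergman_proj_eqI)
    show "square_integrable (\<lambda>z. (z ^ n * of_real (cmod z powr (2 * s)) + a * cnj z ^ m) * disk_monomial k z)"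
    proof (rule square_integrable_mult_bounded[where C = "1 + cmod a"])
      fix z :: complex assume z: "cmod z < 1"
      have "cmod (z ^ n * of_real (cmod z powr (2 * s))) \<le> 1"
        using s z by (simp add: norm_mult norm_power mult_le_one power_le_one powr_le1)
      moreover have "cmod (a * cnj z ^ m) \<le> cmod a"
        using z by (simp add: norm_mult norm_power mult_left_le power_le_one)
      ultimately show "cmod (z ^ n * of_real (cmod z powr (2 * s)) + a * cnj z ^ m) \<le> 1 + cmod a"
        by (meson add_mono norm_triangle_le)
    qed (simp_all add: bergman_square_integrable disk_monomial_bergman)
    show "(\<lambda>z. ?\<alpha> * disk_monomial (n + k) z + a * v z) \<in> bergman"
      by (intro bergman_add bergman_cmult disk_monomial_bergman v)
    fix h assume h: "h \<in> bergman"
    have "disk_inner (\<lambda>z. (z ^ n * of_real (cmod z powr (2 * s)) + a * cnj z ^ m) * disk_monomial k z) h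
        = disk_inner (\<lambda>z. ?f z + a * ?g z) h"
      by (rule disk_inner_cong) (auto simp: disk_monomial_def algebra_simps power_add)
    also have "\<dots> = disk_inner ?f h + a * disk_inner ?g h"
      using f ag h by (simp only: disk_inner_add_left bergman_square_integrable disk_inner_cmult_left)
    also have "disk_inner ?f h = ?\<alpha> * disk_inner (disk_monomial (n + k)) h"
    proof -
      have "complex_of_nat (n + k + 1) \<noteq> 0" by (simp only: of_nat_eq_0_iff)
      \<comment> \<open>The factor \<open>n + k + 1\<close> is the reciprocal of the squared norm of the monomial of degree \<open>n + k\<close>.\<close>
      then have cancel: "c / d = of_nat (n + k + 1) / d * (c / of_nat (n + k + 1))" for c d :: complex
        by (simp del: of_nat_add)
      have "disk_inner ?f h = cnj (taylor_coeff h (n + k)) / of_real (real (n + k) + s + 1)"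
        by (rule disk_inner_power_powr[OF h s])
      also have "\<dots> = ?\<alpha> * disk_inner (disk_monomial (n + k)) h"
        unfolding disk_inner_monomial_left[OF h] of_real_divide of_real_of_nat_eq by (rule cancel)
      finally show ?thesis .
    qed
    also have "disk_inner ?g h = disk_inner v h" by (rule eq[OF h])
    also have "?\<alpha> * disk_inner (disk_monomial (n + k)) h + a * disk_inner v h
       = disk_inner (\<lambda>z. ?\<alpha> * disk_monomial (n + k) z + a * v z) h"
      by (simp only: disk_inner_add_left disk_inner_cmult_left b h)
    finally show "disk_inner (\<lambda>z. (z ^ n * of_real (cmod z powr (2 * s)) + a * cnj z ^ m) * disk_monomial k z) h
       = disk_inner (\<lambda>z. ?\<alpha> * disk_monomial (n + k) z + a * v z) h" .
  qed
qed

text \<open>On the disk, the product of the conjugate of \<open>z\<^sup>m\<close> with \<open>z\<^sup>k\<close> is \<open>z\<^bsup>k-m\<^esup> |z|\<^bsup>2m\<^esup>\<close>, a radially weighted monomial.\<close>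

lemma disk_inner_cnj_power_monomial:
  assumes h: "h \<in> bergman" and "m \<le> k"
  shows "disk_inner (\<lambda>z. cnj z ^ m * disk_monomial k z) h
    = disk_inner (\<lambda>z. of_real (real (k - m + 1) / real (k + 1)) * disk_monomial (k - m) z) h"
proof -
  have "disk_inner (\<lambda>z. cnj z ^ m * disk_monomial k z) h
      = disk_inner (\<lambda>z. z ^ (k - m) * of_real (cmod z ^ (2 * m))) h"
  proof (rule disk_inner_cong)
    fix z :: complex assume z: "cmod z < 1"
    have "z ^ k = z ^ (k - m) * z ^ m" using \<open>m \<le> k\<close> by (simp flip: power_add)
    then show "cnj z ^ m * disk_monomial k z = z ^ (k - m) * of_real (cmod z ^ (2 * m))"
      using z unfolding of_real_cmod_even_power by (simp add: disk_monomial_def)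
  qed simp
  also have "\<dots> = cnj (taylor_coeff h (k - m)) / of_nat (k + 1)"
    using \<open>m \<le> k\<close> by (simp add: disk_inner_power_radial[OF h] del: of_real_power)
  also have "\<dots> = disk_inner (\<lambda>z. of_real (real (k - m + 1) / real (k + 1)) * disk_monomial (k - m) z) h"
    unfolding disk_inner_cmult_left disk_inner_monomial_left[OF h]
    by (simp del: of_nat_add of_nat_Suc)
  finally show ?thesis .
qed

text \<open>Moving the conjugate power to the other side turns the inner product into the value of
  \<open>z\<^sup>m h\<close> at the origin, up to conjugation.\<close>

lemma disk_inner_cnj_power_one:
  assumes h: "h \<in> bergman" and "m > 0"
  shows "disk_inner (\<lambda>z. cnj z ^ m * disk_monomial 0 z) h = 0"
proof -
  have "disk_inner (\<lambda>z. cnj z ^ m * disk_monomial 0 z) h = disk_inner (disk_monomial 0) (\<lambda>z. z ^ m * h z)"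
    unfolding disk_inner_def by (simp add: mult_ac)
  also have "\<dots> = 0"
    using bergman_power_mult[OF h] \<open>m > 0\<close>
    by (simp add: disk_inner_monomial_left taylor_coeff_def)
  finally show ?thesis .
qed

section \<open>The necessary conditions\<close>

text \<open>The hypothesis is the norm inequality for the monomial of degree \<open>k\<close>. With \<open>x = k + 1\<close> the terms of order
  \<open>1/x\<close> and \<open>1/x\<^sup>2\<close> cancel between its two sides, and the terms of order \<open>1/x\<^sup>3\<close> give \<open>A m\<^sup>2 \<le> n (n + 2 s)\<close>.\<close>

lemma coefficient_bound_of_large_monomials:
  fixes A s :: real and m n :: nat
  assumes s: "0 \<le> s" and m: "m > 0"
    and le: "\<And>k. m + n \<le> k \<Longrightarrow>
      real (k - n + 1) / (real k + s + 1)\<^sup>2 + A / real (k + m + 1)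
      \<le> real (n + k + 1) / (real (n + k) + s + 1)\<^sup>2 + A * real (k - m + 1) / (real (k + 1))\<^sup>2"
  shows "A \<le> real n * (real n + 2 * s) / (real m)\<^sup>2"
proof -
  \<comment> \<open>\<open>C\<close> and \<open>D\<close> are the coefficients of the linear polynomial \<open>(x + n) (x + s)\<^sup>2 - (x - n) (x + n + s)\<^sup>2\<close>.\<close>
  define C where "C = real n * s\<^sup>2 + real n * (real n + s)\<^sup>2"
  define D where "D = real n * (real n + 2 * s)"
  have "A * (real m)\<^sup>2 * (x ^ 3 / (x\<^sup>2 * (x + real m)))
      \<le> x ^ 3 * (x * D + C) / ((x + s)\<^sup>2 * (x + real n + s)\<^sup>2)"
    if k: "m + n \<le> k" and x: "x = real k + 1" for k x
  proof -
    have x0: "x > 0" by (simp add: x)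
    have 1: "(x - real n) / (x + s)\<^sup>2 + A / (x + real m)
       \<le> (x + real n) / (x + real n + s)\<^sup>2 + A * (x - real m) / x\<^sup>2"
      using le[OF k] k by (simp add: x of_nat_diff algebra_simps)
    have 2: "A / (x + real m) - A * (x - real m) / x\<^sup>2 = A * (real m)\<^sup>2 / (x\<^sup>2 * (x + real m))"
      using x0 by (simp add: field_simps power2_eq_square add_nonneg_eq_0_iff)
    have 3: "(x + real n) / (x + real n + s)\<^sup>2 - (x - real n) / (x + s)\<^sup>2
       = (x * D + C) / ((x + s)\<^sup>2 * (x + real n + s)\<^sup>2)"
    proof -
      have "x + s \<noteq> 0" "x + real n + s \<noteq> 0" using x0 s by auto
      moreover have "(x + real n) * (x + s)\<^sup>2 - (x - real n) * (x + real n + s)\<^sup>2 = x * D + C"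
        by (simp add: D_def C_def power2_eq_square algebra_simps)
      ultimately show ?thesis by (simp add: diff_frac_eq mult.commute)
    qed
    have "A * (real m)\<^sup>2 / (x\<^sup>2 * (x + real m)) \<le> (x * D + C) / ((x + s)\<^sup>2 * (x + real n + s)\<^sup>2)"
      using 1 2 3 by linarith
    then have "x ^ 3 * (A * (real m)\<^sup>2 / (x\<^sup>2 * (x + real m))) \<le> x ^ 3 * ((x * D + C) / ((x + s)\<^sup>2 * (x + real n + s)\<^sup>2))"
      using x0 by (intro mult_left_mono) auto
    then show ?thesis by (simp add: mult_ac)
  qed
  then have ev: "eventually (\<lambda>k. A * (real m)\<^sup>2 * ((real k + 1) ^ 3 / ((real k + 1)\<^sup>2 * ((real k + 1) + real m)))
      \<le> (real k + 1) ^ 3 * ((real k + 1) * D + C) / (((real k + 1) + s)\<^sup>2 * ((real k + 1) + real n + s)\<^sup>2)) sequentially"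
    by (intro eventually_sequentiallyI[of "m + n"]) blast
  have l1: "(\<lambda>k. A * (real m)\<^sup>2 * ((real k + 1) ^ 3 / ((real k + 1)\<^sup>2 * ((real k + 1) + real m)))) \<longlonglongrightarrow> A * (real m)\<^sup>2 * 1"
    by (intro tendsto_mult_left) real_asymp
  have "(\<lambda>k. (real k + 1) ^ 3 * (real k + 1) / (((real k + 1) + s)\<^sup>2 * ((real k + 1) + real n + s)\<^sup>2)) \<longlonglongrightarrow> 1"
    "(\<lambda>k. (real k + 1) ^ 3 / (((real k + 1) + s)\<^sup>2 * ((real k + 1) + real n + s)\<^sup>2)) \<longlonglongrightarrow> 0"
    by real_asymp+
  then have "(\<lambda>k. D * ((real k + 1) ^ 3 * (real k + 1) / (((real k + 1) + s)\<^sup>2 * ((real k + 1) + real n + s)\<^sup>2))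
     + C * ((real k + 1) ^ 3 / (((real k + 1) + s)\<^sup>2 * ((real k + 1) + real n + s)\<^sup>2))) \<longlonglongrightarrow> D * 1 + C * 0"
    by (intro tendsto_add tendsto_mult_left)
  moreover have "D * (u * (real k + 1) / w) + C * (u / w) = u * ((real k + 1) * D + C) / w" for k u w
    by (simp add: add_divide_distrib algebra_simps)
  ultimately have l2: "(\<lambda>k. (real k + 1) ^ 3 * ((real k + 1) * D + C) / (((real k + 1) + s)\<^sup>2 * ((real k + 1) + real n + s)\<^sup>2)) \<longlonglongrightarrow> D * 1 + C * 0"
    by simp
  have "A * (real m)\<^sup>2 * 1 \<le> D * 1 + C * 0"
    by (rule tendsto_le[OF sequentially_bot l2 l1 ev])
  then show ?thesis using m by (simp add: D_def pos_le_divide_eq)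
qed

theorem theorem1p5:
  fixes s :: real and m n :: nat and a :: complex
  assumes "s > 0" and "m > 0" and "n > 0"
    and "hyponormal (toeplitz (\<lambda>z. z ^ n * of_real (cmod z powr (2 * s)) + a * cnj z ^ m))"
  shows "(cmod a)\<^sup>2 \<le> min ((real m + 1) * (real n + 1) / (real n + s + 1)\<^sup>2)
                           (real n * (real n + 2 * s) / (real m)\<^sup>2)"
proof -
  define T where "T = toeplitz (\<lambda>z. z ^ n * of_real (cmod z powr (2 * s)) + a * cnj z ^ m)"
  define \<alpha> where "\<alpha> = (\<lambda>k. real (n + k + 1) / (real (n + k) + s + 1))"
  define \<gamma> where "\<gamma> = (\<lambda>k. real (k - m + 1) / real (k + 1))"
  obtain S where S: "\<And>f. f \<in> bergman \<Longrightarrow> S f \<in> bergman"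
    and adj: "\<And>f g. f \<in> bergman \<Longrightarrow> g \<in> bergman \<Longrightarrow> disk_inner (T f) g = disk_inner f (S g)"
    and le: "\<And>f. f \<in> bergman \<Longrightarrow> Re (disk_inner (S f) (S f)) \<le> Re (disk_inner (T f) (T f))"
    using hyponormal_norm_le[OF assms(4)] unfolding T_def[symmetric] by metis
  note e = disk_monomial_bergman
  have T: "T (disk_monomial k) = (\<lambda>z. of_real (\<alpha> k) * disk_monomial (n + k) z
      + (a * of_real (\<gamma> k)) * disk_monomial (k - m) z)" if "m \<le> k" for k
    using toeplitz_monomial[OF less_imp_le[OF \<open>s > 0\<close>] bergman_cmult[OF e] disk_inner_cnj_power_monomial[OF _ that], where n = n and a = a]
    unfolding T_def \<alpha>_def \<gamma>_def by (simp only: mult.assoc)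
  have "(\<lambda>_. 0) \<in> bergman" by (simp add: bergman_def)
  moreover have "disk_inner (\<lambda>_. 0) h = 0" for h by (simp add: disk_inner_def)
  ultimately have T0: "T (disk_monomial 0) = (\<lambda>z. of_real (\<alpha> 0) * disk_monomial n z)"
    using toeplitz_monomial[of s "\<lambda>_. 0" m 0 n a] \<open>s > 0\<close> disk_inner_cnj_power_one[OF _ \<open>m > 0\<close>]
    unfolding T_def \<alpha>_def by simp
  have coeff: "disk_inner (disk_monomial j) (S (disk_monomial k)) =
      of_real (\<alpha> j) * (if n + j = k then 1 / of_nat (k + 1) else 0)
      + (a * of_real (\<gamma> j)) * (if j - m = k then 1 / of_nat (k + 1) else 0)" if "m \<le> j" for j k
    by (simp only: adj[symmetric] e T[OF that] disk_inner_monomial_combination_left disk_inner_monomials)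
  have "(cmod a)\<^sup>2 \<le> (real m + 1) * (real n + 1) / (real n + s + 1)\<^sup>2"
  proof -
    have "disk_inner (disk_monomial m) (S (disk_monomial 0)) = a / of_nat (m + 1)"
      using coeff[of m 0] \<open>m > 0\<close> by (simp add: \<gamma>_def)
    then have "real (m + 1) * (cmod (a / of_nat (m + 1)))\<^sup>2 \<le> Re (disk_inner (S (disk_monomial 0)) (S (disk_monomial 0)))"
      using bessel_inequality_pair[OF S[OF e[of 0]], of m 0] \<open>m > 0\<close>
      by (smt (verit) mult_nonneg_nonneg of_nat_0_le_iff zero_le_power2 not_gr_zero)
    also have "\<dots> \<le> Re (disk_inner (T (disk_monomial 0)) (T (disk_monomial 0)))"
      by (rule le[OF e])
    also have "\<dots> = (\<alpha> 0)\<^sup>2 / real (n + 1)"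
      by (simp add: T0 disk_inner_cmult_left disk_inner_cmult_right disk_inner_monomials power2_eq_square del: of_nat_add of_nat_Suc)
    finally have "real (m + 1) * (cmod a / real (m + 1))\<^sup>2 \<le> (real (n + 1) / (real n + s + 1))\<^sup>2 / real (n + 1)"
      by (simp add: norm_divide \<alpha>_def del: of_nat_add of_nat_Suc)
    then have "(cmod a)\<^sup>2 / (real m + 1) \<le> (real n + 1) / (real n + s + 1)\<^sup>2"
      by (simp add: power_divide power2_eq_square add_ac)
    then show ?thesis by (simp add: pos_divide_le_eq mult_ac)
  qed
  moreover have "(cmod a)\<^sup>2 \<le> real n * (real n + 2 * s) / (real m)\<^sup>2"
  proof (rule coefficient_bound_of_large_monomials)
    fix k assume k: "m + n \<le> k"
    \<comment> \<open>These are the two degrees in which the adjoint applied to \<open>z\<^sup>k\<close> has components: \<open>k - n\<close> from the first summand of the symbol and \<open>k + m\<close> from the second.\<close>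
    have c1: "cmod (disk_inner (disk_monomial (k - n)) (S (disk_monomial k))) = 1 / (real k + s + 1)"
    proof -
      have "k - n - m \<noteq> k" "n + (k - n) = k" using k \<open>n > 0\<close> by auto
      then have "disk_inner (disk_monomial (k - n)) (S (disk_monomial k)) = of_real (\<alpha> (k - n) / real (k + 1))"
        using coeff[of "k - n" k] k by simp
      moreover have "\<alpha> (k - n) / real (k + 1) = 1 / (real k + s + 1)"
        using \<open>n + (k - n) = k\<close> by (simp add: \<alpha>_def add_ac)
      ultimately show ?thesis using \<open>s > 0\<close> by (simp del: of_real_divide)
    qed
    have c2: "cmod (disk_inner (disk_monomial (k + m)) (S (disk_monomial k))) = cmod a / real (k + m + 1)"
    proof -
      have "disk_inner (disk_monomial (k + m)) (S (disk_monomial k)) = a * of_real (\<gamma> (k + m) / real (k + 1))"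
        using coeff[of "k + m" k] \<open>n > 0\<close> by simp
      moreover have "\<gamma> (k + m) / real (k + 1) = 1 / real (k + m + 1)"
        by (simp add: \<gamma>_def)
      ultimately show ?thesis by (simp add: norm_mult norm_divide del: of_real_divide of_nat_add of_nat_Suc)
    qed
    have ne: "n + k \<noteq> k - m" "k - n \<noteq> k + m" using k \<open>m > 0\<close> \<open>n > 0\<close> by auto
    have "real (k - n + 1) * (1 / (real k + s + 1))\<^sup>2 + real (k + m + 1) * (cmod a / real (k + m + 1))\<^sup>2
        \<le> Re (disk_inner (S (disk_monomial k)) (S (disk_monomial k)))"
      using bessel_inequality_pair[OF S[OF e[of k]] ne(2)] unfolding c1 c2 .
    also have "\<dots> \<le> Re (disk_inner (T (disk_monomial k)) (T (disk_monomial k)))"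
      by (rule le[OF e])
    also have "\<dots> = (\<alpha> k)\<^sup>2 / real (n + k + 1) + (cmod a * \<gamma> k)\<^sup>2 / real (k - m + 1)"
    proof -
      have "0 \<le> \<alpha> k" "0 \<le> \<gamma> k" using \<open>s > 0\<close> by (auto simp: \<alpha>_def \<gamma>_def)
      then show ?thesis
        using k disk_inner_monomial_combination_self[OF ne(1), of "of_real (\<alpha> k)" "a * of_real (\<gamma> k)"]
        by (simp add: T norm_mult del: of_nat_add of_nat_Suc)
    qed
    finally have *: "real (k - n + 1) * (1 / (real k + s + 1))\<^sup>2 + real (k + m + 1) * (cmod a / real (k + m + 1))\<^sup>2
       \<le> (\<alpha> k)\<^sup>2 / real (n + k + 1) + (cmod a * \<gamma> k)\<^sup>2 / real (k - m + 1)" .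
    have cancel: "u * (y / u)\<^sup>2 = y\<^sup>2 / u" "(y * (u / w))\<^sup>2 / u = y\<^sup>2 * u / w\<^sup>2" if "u \<noteq> 0" for u w y :: real
      using that by (simp_all add: power2_eq_square)
    have nz: "real (k + m + 1) \<noteq> 0" "real (n + k + 1) \<noteq> 0" "real (k - m + 1) \<noteq> 0"
      by (simp_all only: of_nat_eq_0_iff)
    have "(\<alpha> k)\<^sup>2 / real (n + k + 1) = real (n + k + 1) / (real (n + k) + s + 1)\<^sup>2"
      using cancel(2)[OF nz(2), of 1 "real (n + k) + s + 1"] by (simp only: \<alpha>_def mult_1 one_power2)
    with * show "real (k - n + 1) / (real k + s + 1)\<^sup>2 + (cmod a)\<^sup>2 / real (k + m + 1)
      \<le> real (n + k + 1) / (real (n + k) + s + 1)\<^sup>2 + (cmod a)\<^sup>2 * real (k - m + 1) / (real (k + 1))\<^sup>2"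
      unfolding \<gamma>_def cancel(1)[OF nz(1)] cancel(2)[OF nz(3)]
      by (simp only: power_divide one_power2 times_divide_eq_right mult_1_right)
  qed (use assms in auto)
  ultimately show ?thesis by simp
qed

end
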